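(* There exists a universal constant $a>0$ (not depending on $n$, $r$ or $c$) such that the following holds. Let $n,r$ be integers with $1\le r\le n/2$, let $c>0$, and let $k=\frac14 n(\log n+c)$ be an integer. Let $Q$ be the probability measure on the symmetric group $S_n$ defined in the context, let $\widetilde{Q^{*k}}$ be the probability measure on the homogeneous space $X=S_n/(S_r\times S_{n-r})$ induced by the $k$-fold convolution $Q^{*k}$, and let $\widetilde U$ be the uniform probability measure on $X$. Then $$\|\widetilde{Q^{*k}}-\widetilde U\|_{\mathrm{TV}}\ \le\ \tfrac12\binom nr^{1/2}\|\widetilde{Q^{*k}}-\widetilde U\|_2\ \le\ a e^{-c/2}.$$
   Context: Let $K\cong S_r\times S_{n-r}$ be the subgroup of $S_n$ of permutations mapping $\{1,\dots,r\}$ to itself and $\{r+1,\dots,n\}$ to itself. Let $T_2$ be the set of all transpositions in $S_n\setminus K$ (there are $r(n-r)$ of them), and $T_2K=\{\tau\kappa:\tau\in T_2,\ \kappa\in K\}$; each element of $T_2K$ is uniquely of the form $\tau\kappa$, and $T_2K\cap K=\emptyset$. The probability measure $Q$ on $S_n$ is $$Q(\kappa)=\frac{n^2-2r(n-r)}{n^2\,r!(n-r)!}\ (\kappa\in K),\qquad Q(\tau\kappa)=\frac{2}{n^2\,r!(n-r)!}\ (\tau\kappa\in T_2K),\qquad Q(\pi)=0\ \text{otherwise.}$$ $X=S_n/K$ is the set of left cosets of $K$. A probability measure $R$ on $S_n$ induces $\widetilde R$ on $X$ by $\widetilde R(xK)=R(xK)=\sum_{\kappa\in K}R(x\kappa)$.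 Convolution: $(R_1*R_2)(g)=\sum_h R_1(gh^{-1})R_2(h)$, and $Q^{*k}$ is the convolution of $Q$ with itself $k$ times. $\widetilde U(x)=1/\binom nr$ for every $x\in X$. For probability measures $\mu,\nu$ on $X$: $\|\mu-\nu\|_{\mathrm{TV}}=\frac12\sum_{x\in X}|\mu(x)-\nu(x)|$ and $\|\mu-\nu\|_2=\big(\sum_{x\in X}|\mu(x)-\nu(x)|^2\big)^{1/2}$ (unnormalized). $\log$ is the natural logarithm. *)

theory Defs
  imports
    "HOL-Algebra.Sym_Groups"
    "HOL-Algebra.Left_Coset"
    "HOL-Analysis.L2_Norm"
begin

definition young_subgroup :: "nat \<Rightarrow> nat \<Rightarrow> (nat \<Rightarrow> nat) set" where
  "young_subgroup n r =
     {\<pi> \<in> carrier (sym_group n). \<pi> ` {1..r} = {1..r} \<and> \<pi> ` {r+1..n} = {r+1..n}}"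

definition outer_transpositions :: "nat \<Rightarrow> nat \<Rightarrow> (nat \<Rightarrow> nat) set" where
  "outer_transpositions n r =
     {Transposition.transpose i j | i j. i \<in> {1..n} \<and> j \<in> {1..n} \<and> i \<noteq> j} - young_subgroup n r"

text \<open>Measures on a finite set are represented by their real-valued mass functions.\<close>

definition step_measure :: "nat \<Rightarrow> nat \<Rightarrow> (nat \<Rightarrow> nat) \<Rightarrow> real" where
  "step_measure n r \<pi> =
     (if \<pi> \<in> young_subgroup n r
        then (real n ^ 2 - 2 * real r * (real n - real r)) / (real n ^ 2 * fact r * fact (n - r))
      else if \<pi> \<in> outer_transpositions n r <#>\<^bsub>sym_group n\<^esub> young_subgroup n r
        then 2 / (real n ^ 2 * fact r * fact (n - r))
      else 0)"

definition group_convolution ::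
    "('a, 'b) monoid_scheme \<Rightarrow> ('a \<Rightarrow> real) \<Rightarrow> ('a \<Rightarrow> real) \<Rightarrow> 'a \<Rightarrow> real" where
  "group_convolution G R1 R2 g = (\<Sum>h\<in>carrier G. R1 (g \<otimes>\<^bsub>G\<^esub> inv\<^bsub>G\<^esub> h) * R2 h)"

text \<open>The zeroth convolution power is the point mass at the identity.\<close>

primrec convolution_power ::
    "('a, 'b) monoid_scheme \<Rightarrow> ('a \<Rightarrow> real) \<Rightarrow> nat \<Rightarrow> 'a \<Rightarrow> real" where
  "convolution_power G R 0 = (\<lambda>g. if g = \<one>\<^bsub>G\<^esub> then 1 else 0)"
| "convolution_power G R (Suc k) = group_convolution G R (convolution_power G R k)"

definition coset_space :: "nat \<Rightarrow> nat \<Rightarrow> (nat \<Rightarrow> nat) set set" where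
  "coset_space n r = lcosets\<^bsub>sym_group n\<^esub> (young_subgroup n r)"

text \<open>A point of the coset space is a coset, itself a set of permutations, and the induced
  measure gives it the total mass of that set.\<close>

definition induced_measure :: "('a \<Rightarrow> real) \<Rightarrow> 'a set \<Rightarrow> real" where
  "induced_measure R C = (\<Sum>g\<in>C. R g)"

definition uniform_coset_measure :: "nat \<Rightarrow> nat \<Rightarrow> (nat \<Rightarrow> nat) set \<Rightarrow> real" where
  "uniform_coset_measure n r C = 1 / real (n choose r)"

definition tv_distance :: "'a set \<Rightarrow> ('a \<Rightarrow> real) \<Rightarrow> ('a \<Rightarrow> real) \<Rightarrow> real" where
  "tv_distance X \<mu> \<nu> = 1 / 2 * (\<Sum>x\<in>X. \<bar>\<mu> x - \<nu> x\<bar>)"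

definition l2_distance :: "'a set \<Rightarrow> ('a \<Rightarrow> real) \<Rightarrow> ('a \<Rightarrow> real) \<Rightarrow> real" where
  "l2_distance X \<mu> \<nu> = L2_set (\<lambda>x. \<mu> x - \<nu> x) X"

end

theory Submission
  imports Defs "HOL-Real_Asymp.Real_Asymp"
begin

text \<open>
  A coset \<open>gK\<close> is determined by the \<open>r\<close>-subset \<open>g ` {1..r}\<close>, and \<open>Q\<close> is bi-invariant under \<open>K\<close>, so
  the process induced on the cosets is a Markov chain on the \<open>r\<close>-subsets of \<open>{1..n}\<close>: it exchanges
  a given element of the current set for a given element of its complement with probability
  \<open>2/n\<^sup>2\<close> (\<open>convolution_power_eq_kernel_power\<close>). Its kernel \<open>P\<close> is symmetric and invariant under all
  permutations, so the squared \<open>L2\<close> distance from uniform is \<open>P\<^sup>2\<^sup>k(S, S) - 1/N\<close> with \<open>N\<close> the number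
  of \<open>r\<close>-subsets, and by transitivity \<open>N P\<^sup>2\<^sup>k(S, S)\<close> is the trace of \<open>P\<^sup>2\<^sup>k\<close>. The total variation
  bound is then the Cauchy-Schwarz inequality.

  The trace is computed without representation theory or eigenvectors. Up to scaling and a multiple
  of the identity, \<open>P\<close> is \<open>UD\<close>, where \<open>D\<close> and \<open>U\<close> sum over the subsets one smaller and one larger.
  Since \<open>UD\<close> and \<open>DU\<close> have the same nonzero spectrum, and \<open>DU\<close> on the \<open>i\<close>-subsets differs from the
  operator \<open>UD\<close> on the \<open>i\<close>-subsets by the scalar \<open>n - 2i\<close>, the trace of any power of \<open>a + b UD\<close> on
  one level reduces to the level below, apart from the eigenvalue \<open>0\<close> of \<open>UD\<close>, whose multiplicity is
  the difference of the two dimensions. This gives the eigenvalues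
  \<open>\<lambda>\<^sub>j = 1 - 2j(n - j + 1)/n\<^sup>2\<close> with multiplicities \<open>d\<^sub>j = (n choose j) - (n choose (j-1))\<close>
  (\<open>trace_johnson_power\<close>), so that the squared distance times \<open>N\<close> is the sum of
  \<open>d\<^sub>j \<lambda>\<^sub>j\<^sup>2\<^sup>k\<close> over \<open>1 \<le> j \<le> r\<close> (\<open>l2_distance_spectral\<close>).

  For \<open>4k = n (ln n + c)\<close>, the bounds \<open>d\<^sub>j \<le> n\<^sup>j/j!\<close> and \<open>0 \<le> \<lambda>\<^sub>j \<le> exp (-2j(n - j + 1)/n\<^sup>2)\<close> leave
  \<open>exp (-c)\<close> times \<open>exp (ln n \<cdot> j(j-1)/n) / j!\<close>. As \<open>ln x / x\<close> decreases for \<open>x \<ge> e\<close> and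
  \<open>n \<ge> 2j\<close>, the latter is at most \<open>(2j) powr ((j-1)/2) / j!\<close>, which is free of \<open>n\<close> and summable in
  \<open>j\<close> (\<open>eigenvalue_term_bound\<close>, \<open>summable_comparison_term\<close>).
\<close>

section \<open>Traces of affine powers of kernels\<close>

text \<open>
  Matrices are real functions of two arguments, and the finite index sets enter only as the
  summation ranges of the products. The levels of the subset lattice, which vary in an induction
  below, can then serve as index sets.
\<close>

definition kernel_mult :: "'b set \<Rightarrow> ('a \<Rightarrow> 'b \<Rightarrow> real) \<Rightarrow> ('b \<Rightarrow> 'c \<Rightarrow> real) \<Rightarrow> 'a \<Rightarrow> 'c \<Rightarrow> real" where
  "kernel_mult J A B = (\<lambda>x z. \<Sum>y\<in>J. A x y * B y z)"

primrec kernel_power :: "'a set \<Rightarrow> ('a \<Rightarrow> 'a \<Rightarrow> real) \<Rightarrow> nat \<Rightarrow> 'a \<Rightarrow> 'a \<Rightarrow> real" where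
  "kernel_power I A 0 = (\<lambda>x y. of_bool (x = y))"
| "kernel_power I A (Suc m) = kernel_mult I (kernel_power I A m) A"

definition kernel_trace :: "'a set \<Rightarrow> ('a \<Rightarrow> 'a \<Rightarrow> real) \<Rightarrow> real" where
  "kernel_trace I A = (\<Sum>x\<in>I. A x x)"

definition kernel_affine :: "real \<Rightarrow> real \<Rightarrow> ('a \<Rightarrow> 'a \<Rightarrow> real) \<Rightarrow> 'a \<Rightarrow> 'a \<Rightarrow> real" where
  "kernel_affine a b A = (\<lambda>x y. a * of_bool (x = y) + b * A x y)"

lemma kernel_mult_assoc:
  "kernel_mult J (kernel_mult I A B) C = kernel_mult I A (kernel_mult J B C)"
proof (intro ext)
  fix x z
  have "kernel_mult J (kernel_mult I A B) C x z = (\<Sum>w\<in>J. \<Sum>y\<in>I. A x y * B y w * C w z)"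
    by (simp add: kernel_mult_def sum_distrib_right)
  also have "\<dots> = (\<Sum>y\<in>I. \<Sum>w\<in>J. A x y * B y w * C w z)"
    by (rule sum.swap)
  also have "\<dots> = kernel_mult I A (kernel_mult J B C) x z"
    by (simp add: kernel_mult_def sum_distrib_left mult.assoc)
  finally show "kernel_mult J (kernel_mult I A B) C x z = kernel_mult I A (kernel_mult J B C) x z" .
qed

lemma kernel_mult_cong:
  assumes "\<And>y. y \<in> J \<Longrightarrow> A x y = A' x y" and "\<And>y. y \<in> J \<Longrightarrow> B y z = B' y z"
  shows "kernel_mult J A B x z = kernel_mult J A' B' x z"
  unfolding kernel_mult_def using assms by (auto intro!: sum.cong)

lemma kernel_mult_identity_right:
  assumes "finite I" "z \<in> I"
  shows "kernel_mult I A (\<lambda>x y. of_bool (x = y)) x z = A x z"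
  using assms by (simp add: kernel_mult_def of_bool_def if_distrib sum.delta cong: if_cong)

lemma kernel_mult_identity_left:
  assumes "finite I" "x \<in> I"
  shows "kernel_mult I (\<lambda>x y. of_bool (x = y)) A x z = A x z"
  using assms by (simp add: kernel_mult_def of_bool_def if_distrib[of "\<lambda>u. u * _"] sum.delta' cong: if_cong)

lemma kernel_mult_affine_right:
  assumes "finite I" "z \<in> I"
  shows "kernel_mult I C (kernel_affine a b A) x z = a * C x z + b * kernel_mult I C A x z"
proof -
  have "kernel_mult I C (kernel_affine a b A) x z
      = a * kernel_mult I C (\<lambda>x y. of_bool (x = y)) x z + b * kernel_mult I C A x z"
    by (simp add: kernel_mult_def kernel_affine_def algebra_simps sum.distrib sum_distrib_left)
  then show ?thesis using assms by (simp add: kernel_mult_identity_right)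
qed

lemma kernel_mult_affine_left:
  assumes "finite I" "x \<in> I"
  shows "kernel_mult I (kernel_affine a b A) C x z = a * C x z + b * kernel_mult I A C x z"
proof -
  have "kernel_mult I (kernel_affine a b A) C x z
      = a * kernel_mult I (\<lambda>x y. of_bool (x = y)) C x z + b * kernel_mult I A C x z"
    by (simp add: kernel_mult_def kernel_affine_def algebra_simps sum.distrib sum_distrib_left)
  then show ?thesis using assms by (simp add: kernel_mult_identity_left)
qed

lemma kernel_power_add:
  assumes "finite I" "x \<in> I" "z \<in> I"
  shows "kernel_power I A (l + m) x z = kernel_mult I (kernel_power I A l) (kernel_power I A m) x z"
  using assms(3)
proof (induction m arbitrary: z)
  case 0
  then show ?case using assms by (simp add: kernel_mult_identity_right)
next
  case (Suc m)
  have "kernel_power I A (l + Suc m) x z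
      = kernel_mult I (kernel_mult I (kernel_power I A l) (kernel_power I A m)) A x z"
    unfolding add_Suc_right kernel_power.simps by (intro kernel_mult_cong Suc.IH) auto
  then show ?case by (simp add: kernel_mult_assoc)
qed

lemma kernel_power_Suc_left:
  assumes "finite I" "x \<in> I" "z \<in> I"
  shows "kernel_power I A (Suc m) x z = kernel_mult I A (kernel_power I A m) x z"
proof -
  have "kernel_power I A (1 + m) x z = kernel_mult I (kernel_power I A 1) (kernel_power I A m) x z"
    using assms by (rule kernel_power_add)
  also have "\<dots> = kernel_mult I A (kernel_power I A m) x z"
    using assms by (intro kernel_mult_cong) (simp_all add: kernel_mult_identity_left)
  finally show ?thesis by simp
qed

lemma kernel_power_cong:
  assumes "\<And>x y. x \<in> I \<Longrightarrow> y \<in> I \<Longrightarrow> A x y = B x y" "x \<in> I" "y \<in> I"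
  shows "kernel_power I A m x y = kernel_power I B m x y"
  using assms(2,3)
proof (induction m arbitrary: y)
  case (Suc m)
  then show ?case using assms(1) by (auto intro!: kernel_mult_cong)
qed simp

lemma kernel_power_symmetric:
  assumes "finite I" and sym: "\<And>x y. x \<in> I \<Longrightarrow> y \<in> I \<Longrightarrow> A x y = A y x" and "x \<in> I" "y \<in> I"
  shows "kernel_power I A m x y = kernel_power I A m y x"
  using assms(3,4)
proof (induction m arbitrary: x y)
  case (Suc m)
  have "kernel_power I A (Suc m) x y = kernel_mult I A (kernel_power I A m) y x"
    using Suc by (auto simp: kernel_mult_def sym mult.commute intro!: sum.cong)
  then show ?case using Suc.prems assms(1) by (metis kernel_power_Suc_left)
qed auto

text \<open>
  Reindexing every intermediate point of a path by \<open>f\<close> leaves its weight unchanged.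
\<close>

lemma kernel_power_equivariant:
  assumes f: "bij_betw f I I" and inv: "\<And>x y. x \<in> I \<Longrightarrow> y \<in> I \<Longrightarrow> A (f x) (f y) = A x y"
    and "x \<in> I" "y \<in> I"
  shows "kernel_power I A m (f x) (f y) = kernel_power I A m x y"
  using assms(3,4)
proof (induction m arbitrary: y)
  case 0
  have "f x = f y \<longleftrightarrow> x = y"
    using 0 f inj_on_eq_iff[of f I x y] assms(3) by (auto dest: bij_betw_imp_inj_on)
  then show ?case by simp
next
  case (Suc m)
  have "kernel_power I A (Suc m) (f x) (f y)
      = (\<Sum>w\<in>I. kernel_power I A m (f x) (f w) * A (f w) (f y))"
    unfolding kernel_power.simps kernel_mult_def by (rule sum.reindex_bij_betw[OF f, symmetric])
  also have "\<dots> = kernel_power I A (Suc m) x y"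
    using Suc by (auto simp: kernel_mult_def inv intro!: sum.cong)
  finally show ?case .
qed

lemma kernel_power_row_sum:
  assumes "finite I" and "\<And>x. x \<in> I \<Longrightarrow> (\<Sum>y\<in>I. A x y) = 1" and "x \<in> I"
  shows "(\<Sum>y\<in>I. kernel_power I A m x y) = 1"
proof (induction m)
  case 0
  have "(\<Sum>y\<in>I. kernel_power I A 0 x y) = (\<Sum>y\<in>I. if x = y then 1 else 0)"
    by (simp add: of_bool_def)
  also have "\<dots> = 1"
    using assms(1,3) by simp
  finally show ?case .
next
  case (Suc m)
  have "(\<Sum>y\<in>I. kernel_power I A (Suc m) x y) = (\<Sum>w\<in>I. \<Sum>y\<in>I. kernel_power I A m x w * A w y)"
    unfolding kernel_power.simps kernel_mult_def by (rule sum.swap)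
  also have "\<dots> = (\<Sum>w\<in>I. kernel_power I A m x w)"
    using assms by (simp add: sum_distrib_left[symmetric])
  finally show ?case using Suc by simp
qed

lemma kernel_trace_mult_commute:
  "kernel_trace I (kernel_mult J A B) = kernel_trace J (kernel_mult I B A)"
  unfolding kernel_trace_def kernel_mult_def
  by (subst sum.swap) (simp add: mult.commute)

text \<open>
  The trace form of the fact that \<open>UD\<close> and \<open>DU\<close> differ only in the multiplicity of the
  eigenvalue \<open>0\<close>. Write \<open>X = a + b UD\<close> and \<open>Y = a + b DU\<close>. From \<open>X U = U Y\<close> one gets
  \<open>X\<^sup>m U = U Y\<^sup>m\<close>, hence \<open>tr (X\<^sup>m U D) = tr (U Y\<^sup>m D) = tr (Y\<^sup>m D U)\<close>; so passing from \<open>m\<close> to \<open>m + 1\<close>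
  multiplies the difference of the two traces by \<open>a\<close>.
\<close>

lemma kernel_trace_affine_power_swap:
  assumes I: "finite I" and J: "finite J"
  shows "kernel_trace I (kernel_power I (kernel_affine a b (kernel_mult J U D)) m)
       = kernel_trace J (kernel_power J (kernel_affine a b (kernel_mult I D U)) m)
         + a ^ m * (real (card I) - real (card J))"
proof -
  let ?X = "kernel_affine a b (kernel_mult J U D)" and ?Y = "kernel_affine a b (kernel_mult I D U)"
  have intertwine: "kernel_mult I (kernel_power I ?X m) U x y = kernel_mult J U (kernel_power J ?Y m) x y"
    if x: "x \<in> I" and y: "y \<in> J" for x y m
    using y
  proof (induction m arbitrary: y)
    case 0
    then show ?case using x I J
      by (simp add: kernel_mult_identity_left kernel_mult_identity_right)
  next
    case (Suc m)
    have "kernel_mult I (kernel_power I ?X (Suc m)) U x y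
        = kernel_mult I (kernel_power I ?X m) (kernel_mult I ?X U) x y"
      by (simp add: kernel_mult_assoc)
    also have "\<dots> = kernel_mult I (kernel_power I ?X m) (kernel_mult J U ?Y) x y"
      using I J Suc.prems
      by (intro kernel_mult_cong)
        (simp_all add: kernel_mult_affine_left kernel_mult_affine_right kernel_mult_assoc)
    also have "\<dots> = kernel_mult J (kernel_mult I (kernel_power I ?X m) U) ?Y x y"
      by (simp add: kernel_mult_assoc)
    also have "\<dots> = kernel_mult J (kernel_mult J U (kernel_power J ?Y m)) ?Y x y"
      using Suc.IH by (intro kernel_mult_cong) auto
    finally show ?case by (simp add: kernel_mult_assoc)
  qed
  have step: "kernel_trace K (kernel_power K (kernel_affine a b C) (Suc m))
      = a * kernel_trace K (kernel_power K (kernel_affine a b C) m)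
        + b * kernel_trace K (kernel_mult K (kernel_power K (kernel_affine a b C) m) C)"
    if "finite K" for K :: "'z set" and C m
    using that by (simp add: kernel_trace_def kernel_mult_affine_right sum.distrib sum_distrib_left)
  show ?thesis
  proof (induction m)
    case 0
    then show ?case by (simp add: kernel_trace_def)
  next
    case (Suc m)
    have "kernel_trace I (kernel_mult I (kernel_power I ?X m) (kernel_mult J U D))
        = kernel_trace I (kernel_mult J (kernel_mult J U (kernel_power J ?Y m)) D)"
      unfolding kernel_mult_assoc[symmetric] kernel_trace_def
      by (intro sum.cong refl kernel_mult_cong) (auto simp: intertwine)
    also have "\<dots> = kernel_trace J (kernel_mult J (kernel_power J ?Y m) (kernel_mult I D U))"
      by (simp add: kernel_mult_assoc kernel_trace_mult_commute[of I])
    finally show ?case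
      using I J Suc by (simp only: step[OF I] step[OF J]) (simp add: algebra_simps)
  qed
qed


section \<open>The spectrum of the Johnson scheme by traces\<close>

definition level :: "'a set \<Rightarrow> nat \<Rightarrow> 'a set set" where
  "level V r = {S. S \<subseteq> V \<and> card S = r}"

text \<open>
  The adjacency matrix of the Johnson graph, shifted by \<open>r\<close> on the diagonal: with this shift it is
  the product \<open>UD\<close> of the two inclusion matrices between consecutive levels, for \<open>r > 0\<close>, and it is
  \<open>0\<close> on the only point of level \<open>0\<close>.
\<close>

definition johnson_kernel :: "nat \<Rightarrow> 'a set \<Rightarrow> 'a set \<Rightarrow> real" where
  "johnson_kernel r S T = (if S = T then real r else of_bool (card (S \<inter> T) + 1 = r))"

lemma finite_level: "finite V \<Longrightarrow> finite (level V r)"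
  unfolding level_def by (rule finite_subset[of _ "Pow V"]) auto

lemma card_level: "finite V \<Longrightarrow> card (level V r) = card V choose r"
  unfolding level_def by (simp add: n_subsets)

text \<open>
  The entry counts the \<open>i\<close>-subsets of \<open>S \<inter> T\<close>, of which there are \<open>i + 1\<close>, one or none.
\<close>

lemma inclusion_mult_below:
  assumes V: "finite V" and S: "S \<in> level V (Suc i)" and T: "T \<in> level V (Suc i)"
  shows "kernel_mult (level V i) (\<lambda>S R. of_bool (R \<subseteq> S)) (\<lambda>R T. of_bool (R \<subseteq> T)) S T
       = johnson_kernel (Suc i) S T"
proof -
  have fin: "finite S" "finite T" and c: "card S = Suc i" "card T = Suc i"
    using S T V by (auto simp: level_def intro: finite_subset)
  have "kernel_mult (level V i) (\<lambda>S R. of_bool (R \<subseteq> S)) (\<lambda>R T. of_bool (R \<subseteq> T)) S T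
      = (\<Sum>R\<in>level V i. of_bool (R \<subseteq> S \<inter> T))"
    unfolding kernel_mult_def by (intro sum.cong) auto
  also have "\<dots> = real (card {R \<in> level V i. R \<subseteq> S \<inter> T})"
    using finite_level[OF V, of i] by (simp add: of_bool_def sum.If_cases Int_def)
  also have "{R \<in> level V i. R \<subseteq> S \<inter> T} = {R. R \<subseteq> S \<inter> T \<and> card R = i}"
    using S by (auto simp: level_def)
  also have "card \<dots> = card (S \<inter> T) choose i"
    by (rule n_subsets) (use fin in simp)
  also have "real \<dots> = johnson_kernel (Suc i) S T"
  proof (cases "S = T")
    case True
    then show ?thesis using c by (simp add: johnson_kernel_def)
  next
    case False
    have "card (S \<inter> T) \<noteq> Suc i"
      using False fin c by (metis card_subset_eq inf_le1 inf_le2)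
    moreover have "card (S \<inter> T) \<le> Suc i"
      using fin c by (metis card_mono inf_le1)
    ultimately consider "card (S \<inter> T) = i" | "card (S \<inter> T) < i" by linarith
    then show ?thesis
      using False by cases (simp_all add: johnson_kernel_def binomial_eq_0)
  qed
  finally show ?thesis .
qed

lemma card_one_element_extensions:
  assumes V: "finite V" and R: "R \<in> level V i"
  shows "card {S \<in> level V (Suc i). R \<subseteq> S} = card V - i"
proof -
  have fR: "finite R" and RV: "R \<subseteq> V" and cR: "card R = i"
    using assms by (auto simp: level_def intro: finite_subset)
  have "{S \<in> level V (Suc i). R \<subseteq> S} = (\<lambda>x. insert x R) ` (V - R)"
  proof (intro equalityI subsetI)
    fix S assume S: "S \<in> {S \<in> level V (Suc i). R \<subseteq> S}"
    then have "card (S - R) = 1"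
      using fR cR by (simp add: level_def card_Diff_subset)
    then obtain x where "S - R = {x}" by (rule card_1_singletonE)
    then have "S = insert x R" "x \<in> V - R"
      using S by (auto simp: level_def)
    then show "S \<in> (\<lambda>x. insert x R) ` (V - R)" by blast
  next
    fix S assume "S \<in> (\<lambda>x. insert x R) ` (V - R)"
    then show "S \<in> {S \<in> level V (Suc i). R \<subseteq> S}"
      using fR RV cR by (auto simp: level_def)
  qed
  moreover have "inj_on (\<lambda>x. insert x R) (V - R)"
    by (auto simp: inj_on_def)
  ultimately show ?thesis
    using V RV fR cR by (simp add: card_image card_Diff_subset)
qed

text \<open>
  The commutation relation \<open>DU - UD = n - 2i\<close> of the Boolean lattice: two distinct \<open>i\<close>-sets have a
  common extension by one element iff they have a common restriction by one, and then both are
  unique, so only the diagonals \<open>n - i\<close> and \<open>i\<close> differ.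
\<close>

lemma inclusion_mult_above:
  assumes V: "finite V" and R: "R \<in> level V i" and R': "R' \<in> level V i"
  shows "kernel_mult (level V (Suc i)) (\<lambda>R S. of_bool (R \<subseteq> S)) (\<lambda>S R. of_bool (R \<subseteq> S)) R R'
       = kernel_affine (real (card V) - 2 * real i) 1 (johnson_kernel i) R R'"
proof -
  have fin: "finite R" "finite R'" and c: "card R = i" "card R' = i" and RV: "R \<subseteq> V" "R' \<subseteq> V"
    using R R' V by (auto simp: level_def intro: finite_subset)
  have iV: "i \<le> card V" using card_mono[OF V RV(1)] c by simp
  have cU: "card (R \<union> R') + card (R \<inter> R') = 2 * i"
    using card_Un_Int[OF fin] c by simp
  have "kernel_mult (level V (Suc i)) (\<lambda>R S. of_bool (R \<subseteq> S)) (\<lambda>S R. of_bool (R \<subseteq> S)) R R'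
      = (\<Sum>S\<in>level V (Suc i). of_bool (R \<union> R' \<subseteq> S))"
    unfolding kernel_mult_def by (intro sum.cong) auto
  also have "\<dots> = real (card {S \<in> level V (Suc i). R \<union> R' \<subseteq> S})"
    using finite_level[OF V, of "Suc i"] by (simp add: of_bool_def sum.If_cases Int_def)
  also have "\<dots> = kernel_affine (real (card V) - 2 * real i) 1 (johnson_kernel i) R R'"
  proof (cases "R = R'")
    case True
    then show ?thesis
      using card_one_element_extensions[OF V R] iV
      by (simp add: kernel_affine_def johnson_kernel_def of_nat_diff)
  next
    case False
    have "card (R \<inter> R') \<noteq> i"
      using False fin c by (metis card_subset_eq inf_le1 inf_le2)
    moreover have "card (R \<inter> R') \<le> i"
      using fin c by (metis card_mono inf_le1)
    ultimately have lt: "card (R \<inter> R') < i" by linarith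
    show ?thesis
    proof (cases "card (R \<inter> R') + 1 = i")
      case True
      then have "card (R \<union> R') = Suc i" using cU by linarith
      moreover have "S = R \<union> R'" if "S \<in> level V (Suc i)" "R \<union> R' \<subseteq> S" for S
        using that V \<open>card (R \<union> R') = Suc i\<close>
        by (metis (mono_tags, lifting) card_subset_eq finite_subset level_def mem_Collect_eq)
      ultimately have "{S \<in> level V (Suc i). R \<union> R' \<subseteq> S} = {R \<union> R'}"
        using RV by (auto simp: level_def)
      then show ?thesis
        using False True by (simp add: kernel_affine_def johnson_kernel_def)
    next
      case nz: False
      then have "card (R \<union> R') > Suc i" using cU lt by linarith
      then have "\<not> R \<union> R' \<subseteq> S" if "S \<in> level V (Suc i)" for S
        using that V by (metis (mono_tags, lifting) card_mono finite_subset level_def mem_Collect_eq leD)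
      then have "{S \<in> level V (Suc i). R \<union> R' \<subseteq> S} = {}" by blast
      then show ?thesis
        using False nz by (simp only: kernel_affine_def johnson_kernel_def) simp
    qed
  qed
  finally show ?thesis .
qed

definition johnson_multiplicity :: "nat \<Rightarrow> nat \<Rightarrow> real" where
  "johnson_multiplicity n j = real (n choose j) - (if j = 0 then 0 else real (n choose (j - 1)))"

lemma kernel_affine_affine:
  "kernel_affine a b (kernel_affine c 1 A) = kernel_affine (a + b * c) b A"
  by (simp add: kernel_affine_def algebra_simps)

text \<open>
  Descent through the levels: exchanging \<open>UD\<close> for \<open>DU\<close> costs the term of multiplicity
  \<open>johnson_multiplicity\<close> with eigenvalue \<open>a\<close>, and the commutation relation absorbs the scalar
  \<open>n - 2i\<close> into \<open>a\<close>. This is why the statement is made for all \<open>a\<close>.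
\<close>

lemma trace_johnson_power:
  assumes V: "finite V"
  shows "kernel_trace (level V r) (kernel_power (level V r) (kernel_affine a b (johnson_kernel r)) m)
       = (\<Sum>j\<le>r. johnson_multiplicity (card V) j
            * (a + b * ((real r - real j) * (real (card V) - real r - real j + 1))) ^ m)"
proof (induction r arbitrary: a)
  case 0
  have L: "level V 0 = {{}}"
    using V by (auto simp: level_def dest: finite_subset)
  have "kernel_power {{}} (kernel_affine a b (johnson_kernel 0)) m {} {} = a ^ m"
    by (induction m) (simp_all add: kernel_mult_def kernel_affine_def johnson_kernel_def)
  then show ?case
    by (simp add: L kernel_trace_def johnson_multiplicity_def)
next
  case (Suc i)
  let ?n = "real (card V)"
  let ?I = "level V (Suc i)" and ?J = "level V i"
  let ?UD = "kernel_mult ?J (\<lambda>S R. of_bool (R \<subseteq> S)) (\<lambda>R T. of_bool (R \<subseteq> T)) :: 'a set \<Rightarrow> 'a set \<Rightarrow> real"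
  let ?DU = "kernel_mult ?I (\<lambda>R T. of_bool (R \<subseteq> T)) (\<lambda>S R. of_bool (R \<subseteq> S)) :: 'a set \<Rightarrow> 'a set \<Rightarrow> real"
  have "kernel_trace ?I (kernel_power ?I (kernel_affine a b (johnson_kernel (Suc i))) m)
      = kernel_trace ?I (kernel_power ?I (kernel_affine a b ?UD) m)"
    unfolding kernel_trace_def
    by (intro sum.cong refl kernel_power_cong)
      (simp_all add: kernel_affine_def inclusion_mult_below[OF V])
  also have "\<dots> = kernel_trace ?J (kernel_power ?J (kernel_affine a b ?DU) m)
      + a ^ m * (real (card ?I) - real (card ?J))"
    using V by (intro kernel_trace_affine_power_swap finite_level)
  also have "kernel_trace ?J (kernel_power ?J (kernel_affine a b ?DU) m)
      = kernel_trace ?J (kernel_power ?J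
          (kernel_affine a b (kernel_affine (?n - 2 * real i) 1 (johnson_kernel i))) m)"
    unfolding kernel_trace_def
    by (intro sum.cong refl kernel_power_cong)
      (simp_all only: kernel_affine_def[of a b] inclusion_mult_above[OF V])
  also have "\<dots> = (\<Sum>j\<le>i. johnson_multiplicity (card V) j
            * (a + b * (?n - 2 * real i) + b * ((real i - real j) * (?n - real i - real j + 1))) ^ m)"
    by (simp only: kernel_affine_affine Suc.IH)
  also have "\<dots> = (\<Sum>j\<le>i. johnson_multiplicity (card V) j
            * (a + b * ((real (Suc i) - real j) * (?n - real (Suc i) - real j + 1))) ^ m)"
    by (intro sum.cong refl arg_cong2[of _ _ _ _ "(*)"] arg_cong[of _ _ "\<lambda>u. u ^ m"])
      (simp add: algebra_simps)
  finally show ?case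
    by (simp add: card_level[OF V] johnson_multiplicity_def)
qed


section \<open>A bound on the spectral sum that is uniform in the dimension\<close>

text \<open>
  The number \<open>(2j) powr ((j-1)/2) / j!\<close>, in the exponential form in which it appears as a bound.
\<close>

definition comparison_term :: "nat \<Rightarrow> real" where
  "comparison_term j = exp ((real j - 1) / 2 * ln (2 * real j)) / fact j"

lemma comparison_term_pos: "comparison_term j > 0"
  by (simp add: comparison_term_def)

lemma power_le_exp_fact: "real j ^ j \<le> exp (real j) * fact j"
proof -
  have "(\<Sum>i\<in>{j}. real j ^ i /\<^sub>R fact i) \<le> (\<Sum>i. real j ^ i /\<^sub>R fact i)"
    by (intro sum_le_suminf summable_exp_generic) auto
  then have "real j ^ j / fact j \<le> exp (real j)"
    by (simp add: exp_def divide_inverse mult.commute)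
  then show ?thesis by (simp add: divide_le_eq)
qed

text \<open>
  Since \<open>j! \<ge> (j/e)\<^sup>j\<close>, the term is at most about \<open>(e \<surd>(2/j))\<^sup>j\<close>.
\<close>

lemma summable_comparison_term: "summable comparison_term"
proof (rule summable_comparison_test_bigo)
  show "summable (\<lambda>j. norm ((1/2::real) ^ j))" by (simp add: summable_geometric)
  have "eventually (\<lambda>j. norm (comparison_term j) \<le> 1 * norm (exp (real j + (real j - 1) / 2 * ln (2 * real j) - real j * ln (real j)))) at_top"
  proof (intro eventually_at_top_linorderI[of 1])
    fix j :: nat assume j: "1 \<le> j"
    have "exp (real j * ln (real j)) = real j ^ j"
      using j by (simp add: exp_of_nat_mult)
    then have "exp (real j * ln (real j)) / exp (real j) \<le> fact j"
      using power_le_exp_fact[of j] by (simp add: divide_le_eq mult.commute)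
    then have "comparison_term j \<le> exp ((real j - 1) / 2 * ln (2 * real j)) / (exp (real j * ln (real j)) / exp (real j))"
      unfolding comparison_term_def by (intro divide_left_mono) simp_all
    also have "\<dots> = exp (real j + (real j - 1) / 2 * ln (2 * real j) - real j * ln (real j))"
      by (simp add: exp_add exp_diff)
    finally show "norm (comparison_term j) \<le> 1 * norm (exp (real j + (real j - 1) / 2 * ln (2 * real j) - real j * ln (real j)))"
      using comparison_term_pos[of j] by simp
  qed
  then have "comparison_term \<in> O(\<lambda>j. exp (real j + (real j - 1) / 2 * ln (2 * real j) - real j * ln (real j)))"
    by (rule bigoI)
  also have "(\<lambda>j. exp (real j + (real j - 1) / 2 * ln (2 * real j) - real j * ln (real j))) \<in> O(\<lambda>j. (1/2) ^ j)"
    by real_asymp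
  finally show "comparison_term \<in> O(\<lambda>j. (1/2) ^ j)" .
qed

text \<open>
  The \<open>j\<close>-th eigenvalue of the walk. It is the same for all subset sizes \<open>r \<ge> j\<close>.
\<close>

definition walk_eigenvalue :: "nat \<Rightarrow> nat \<Rightarrow> real" where
  "walk_eigenvalue n j = 1 - 2 * real j * (real n - real j + 1) / real n ^ 2"

text \<open>
  Nonnegativity follows from \<open>n\<^sup>2 - 2j(n-j+1) = (n-j)\<^sup>2 + (j-1)\<^sup>2 - 1\<close>. It is what allows the
  estimate \<open>1 - x \<le> exp (-x)\<close> to be raised to a power.
\<close>

lemma walk_eigenvalue_nonneg:
  assumes "n \<ge> 2" "2 * j \<le> n"
  shows "walk_eigenvalue n j \<ge> 0"
proof -
  have "real n - real j \<ge> 1" using assms by linarith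
  then have "(real n - real j)\<^sup>2 \<ge> 1"
    using power_mono[of 1 "real n - real j" 2] by simp
  moreover have "(real j - 1)\<^sup>2 \<ge> 0" by simp
  ultimately have "2 * real j * (real n - real j + 1) \<le> real n ^ 2"
    by (simp add: power2_eq_square algebra_simps)
  then show ?thesis using assms by (simp add: walk_eigenvalue_def divide_le_eq)
qed

text \<open>
  With \<open>e = j(n-j+1)/n\<close> the power of the eigenvalue is at most \<open>exp (-(ln n + c) e)\<close>. The part
  with \<open>c\<close> is bounded by \<open>exp (-c)\<close> because \<open>e \<ge> 1\<close>, with equality for \<open>j = 1\<close>. The part with \<open>ln n\<close>
  cancels the factor \<open>n\<^sup>j\<close> of the multiplicity up to \<open>exp (ln n \<cdot> j(j-1)/n)\<close>.
\<close>

lemma eigenvalue_term_bound: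
  assumes n: "n \<ge> 2" and j: "1 \<le> j" "2 * j \<le> n" and c: "c > 0"
    and k: "real k = 1 / 4 * real n * (ln (real n) + c)"
  shows "johnson_multiplicity n j * walk_eigenvalue n j ^ (2 * k) \<le> comparison_term j * exp (- c)"
proof -
  let ?n = "real n" and ?j = "real j"
  define e where "e = ?j * (?n - ?j + 1) / ?n"
  have n0: "?n > 0" and rj: "1 \<le> ?j" "2 * ?j \<le> ?n" using n j by linarith+
  have e: "e = ?j - ?j * (?j - 1) / ?n"
    using n0 by (simp add: e_def field_simps)
  have "(?j - 1) * (?n - ?j) \<ge> 0"
    using rj by (intro mult_nonneg_nonneg) linarith+
  then have e1: "e \<ge> 1"
    using n0 by (simp add: e_def field_simps)
  have "walk_eigenvalue n j = 1 + - (2 / ?n * e)"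
    using n0 by (simp add: walk_eigenvalue_def e_def power2_eq_square)
  also have "\<dots> \<le> exp (- (2 / ?n * e))"
    by (rule exp_ge_add_one_self)
  finally have "walk_eigenvalue n j ^ (2 * k) \<le> exp (- (2 / ?n * e)) ^ (2 * k)"
    using walk_eigenvalue_nonneg[OF n j(2)] by (rule power_mono)
  also have "\<dots> = exp (- (ln ?n + c) * e)"
    using n0 by (simp add: exp_of_nat_mult[symmetric] k field_simps)
  finally have lam: "walk_eigenvalue n j ^ (2 * k) \<le> exp (- (ln ?n + c) * e)" .
  have "real (n choose j) * fact j \<le> ?n ^ j"
    using binomial_fact_pow[of n j] by (metis of_nat_fact of_nat_le_iff of_nat_mult of_nat_power)
  moreover have "johnson_multiplicity n j * fact j \<le> real (n choose j) * fact j"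
    by (intro mult_right_mono) (simp_all add: johnson_multiplicity_def)
  ultimately have "johnson_multiplicity n j * fact j \<le> ?n ^ j" by linarith
  then have mult: "johnson_multiplicity n j \<le> exp (?j * ln ?n) / fact j"
    using n0 by (simp add: pos_le_divide_eq exp_of_nat_mult)
  \<comment> \<open>For \<open>j = 1\<close> both sides vanish; for \<open>j \<ge> 2\<close> we have \<open>2 j \<ge> 4 > e\<close>, where \<open>ln x / x\<close> is decreasing.\<close>
  have key: "ln ?n * (?j * (?j - 1) / ?n) \<le> (?j - 1) / 2 * ln (2 * ?j)"
  proof (cases "j = 1")
    case False
    have "exp 1 \<le> 2 * ?j"
      using exp_le False j by linarith
    then have "ln ?n / ?n \<le> ln (2 * ?j) / (2 * ?j)"
      using rj by (intro ln_x_over_x_mono)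
    then have "(?j * (?j - 1)) * (ln ?n / ?n) \<le> (?j * (?j - 1)) * (ln (2 * ?j) / (2 * ?j))"
      using rj by (intro mult_left_mono) auto
    moreover have "(?j * (?j - 1)) * (ln (2 * ?j) / (2 * ?j)) = (?j - 1) / 2 * ln (2 * ?j)"
      using rj by simp
    ultimately show ?thesis by (simp add: mult.commute)
  qed simp
  have "johnson_multiplicity n j * walk_eigenvalue n j ^ (2 * k)
      \<le> exp (?j * ln ?n) / fact j * exp (- (ln ?n + c) * e)"
    using mult lam walk_eigenvalue_nonneg[OF n j(2)] by (intro mult_mono) auto
  also have "\<dots> = exp (ln ?n * (?j * (?j - 1) / ?n) - c * e) / fact j"
  proof -
    have "?j * (?j - 1) / ?n = ?j - e" using e by simp
    then show ?thesis by (simp only: times_divide_eq_left exp_add[symmetric]) (simp add: algebra_simps)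
  qed
  also have "\<dots> \<le> exp ((?j - 1) / 2 * ln (2 * ?j) - c * 1) / fact j"
  proof -
    have "c * 1 \<le> c * e" using c e1 by (intro mult_left_mono) auto
    then have "ln ?n * (?j * (?j - 1) / ?n) - c * e \<le> (?j - 1) / 2 * ln (2 * ?j) - c * 1"
      using key by linarith
    then show ?thesis
      by (rule divide_right_mono[OF iffD2[OF exp_le_cancel_iff]]) simp
  qed
  also have "\<dots> = comparison_term j * exp (- c)"
    by (simp only: comparison_term_def diff_conv_add_uminus exp_add mult_1_right times_divide_eq_left)
  finally show ?thesis .
qed


section \<open>Cosets as subsets and the walk on them\<close>

lemma image_permutes_level:
  assumes "g permutes V" "S \<in> level V r"
  shows "g ` S \<in> level V r"
  using assms permutes_image[of g V] permutes_inj_on[of g V S]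
  by (auto simp: level_def card_image image_subset_iff permutes_in_image)

lemma image_inverse_permutes:
  assumes "g permutes V"
  shows "inv' g ` g ` S = S" and "g ` inv' g ` S = S"
  using permutes_inv_o[OF assms] by (simp_all only: image_comp image_id id_apply)

lemma bij_betw_image_level:
  assumes g: "g permutes V"
  shows "bij_betw ((`) g) (level V r) (level V r)"
proof (rule bij_betw_byWitness[where f' = "(`) (inv' g)"])
  show "\<forall>S\<in>level V r. inv' g ` g ` S = S"
    using image_inverse_permutes(1)[OF g] by simp
  show "\<forall>S\<in>level V r. g ` inv' g ` S = S"
    using image_inverse_permutes(2)[OF g] by simp
qed (use g image_permutes_level permutes_inv in blast)+

lemma permutes_transitive_level:
  assumes V: "finite V" and S: "S \<in> level V r" and T: "T \<in> level V r"
  shows "\<exists>g. g permutes V \<and> g ` S = T"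
proof -
  have fin: "finite S" "finite T" and sub: "S \<subseteq> V" "T \<subseteq> V" and c: "card S = card T"
    using assms by (auto simp: level_def intro: finite_subset)
  obtain f1 where f1: "bij_betw f1 S T"
    using finite_same_card_bij[OF fin c] by blast
  have "card (V - S) = card (V - T)"
    using fin sub c by (simp add: card_Diff_subset)
  then obtain f2 where f2: "bij_betw f2 (V - S) (V - T)"
    using finite_same_card_bij[of "V - S" "V - T"] V by auto
  let ?f = "\<lambda>x. if x \<in> S then f1 x else if x \<in> V - S then f2 x else x"
  have "bij_betw ?f S T"
    using f1 by (rule bij_betw_cong[THEN iffD1, rotated]) auto
  moreover have "bij_betw ?f (V - S) (V - T)"
    using f2 by (rule bij_betw_cong[THEN iffD1, rotated]) auto
  ultimately have "bij_betw ?f (S \<union> (V - S)) (T \<union> (V - T))"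
    by (rule bij_betw_combine) auto
  moreover have "S \<union> (V - S) = V" "T \<union> (V - T) = V" using sub by auto
  ultimately have "bij_betw ?f V V" by simp
  then have "?f permutes V"
    by (rule bij_imp_permutes) (use sub in auto)
  moreover have "?f ` S = T" using f1 by (auto simp: bij_betw_def)
  ultimately show ?thesis by blast
qed

text \<open>
  The lazy Bernoulli-Laplace walk: by the diagonal entry \<open>r\<close> of the Johnson kernel, it stays put
  with probability \<open>1 - 2r(n-r)/n\<^sup>2\<close> and moves to each neighbour with probability \<open>2/n\<^sup>2\<close>.
\<close>

definition walk_kernel :: "nat \<Rightarrow> nat \<Rightarrow> 'a set \<Rightarrow> 'a set \<Rightarrow> real" where
  "walk_kernel n r = kernel_affine (1 - 2 * real r * (real n - real r + 1) / real n ^ 2)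
     (2 / real n ^ 2) (johnson_kernel r)"

lemma walk_kernel_image:
  assumes "inj g"
  shows "walk_kernel n r (g ` S) (g ` T) = walk_kernel n r S T"
proof -
  have "card (g ` S \<inter> g ` T) = card (S \<inter> T)"
    using assms by (metis card_image image_Int inj_on_subset subset_UNIV)
  then show ?thesis
    using inj_image_eq_iff[OF assms] by (simp add: walk_kernel_def kernel_affine_def johnson_kernel_def)
qed

lemma walk_kernel_symmetric: "walk_kernel n r S T = walk_kernel n r T S"
  by (auto simp: walk_kernel_def kernel_affine_def johnson_kernel_def Int_commute)

text \<open>
  Factoring the Johnson kernel through level \<open>r - 1\<close> counts its row sum: \<open>r\<close> ways to drop an element
  of \<open>S\<close>, then \<open>n - r + 1\<close> ways to add one.
\<close>

lemma walk_kernel_row_sum: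
  assumes V: "finite V" "card V = n" and n: "n > 0" and r: "1 \<le> r" and S: "S \<in> level V r"
  shows "(\<Sum>T\<in>level V r. walk_kernel n r S T) = 1"
proof -
  obtain i where i: "r = Suc i" using r by (cases r) auto
  have fS: "finite S" and SV: "S \<subseteq> V" and cS: "card S = Suc i"
    using S V by (auto simp: level_def i intro: finite_subset)
  have iV: "Suc i \<le> n" using card_mono[OF V(1) SV] cS V(2) by simp
  have "(\<Sum>T\<in>level V r. johnson_kernel r S T)
      = (\<Sum>T\<in>level V r. \<Sum>R\<in>level V i. of_bool (R \<subseteq> S) * of_bool (R \<subseteq> T))"
    using S by (intro sum.cong refl)
      (simp add: i kernel_mult_def flip: inclusion_mult_below[OF V(1)])
  also have "\<dots> = (\<Sum>R\<in>level V i. of_bool (R \<subseteq> S) * (\<Sum>T\<in>level V r. of_bool (R \<subseteq> T)))"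
    by (subst sum.swap) (simp add: sum_distrib_left)
  also have "\<dots> = (\<Sum>R\<in>level V i. of_bool (R \<subseteq> S) * real (n - i))"
    using finite_level[OF V(1), of r] card_one_element_extensions[OF V(1)] V(2)
    by (intro sum.cong refl) (simp add: of_bool_def sum.If_cases Int_def i)
  also have "\<dots> = real (card {R \<in> level V i. R \<subseteq> S}) * real (n - i)"
    using finite_level[OF V(1), of i]
    by (simp add: of_bool_def sum.If_cases Int_def flip: sum_distrib_right)
  also have "{R \<in> level V i. R \<subseteq> S} = {R. R \<subseteq> S \<and> card R = i}"
    using SV by (auto simp: level_def)
  also have "card \<dots> = r"
    using n_subsets[OF fS, of i] cS i by simp
  finally have J: "(\<Sum>T\<in>level V r. johnson_kernel r S T) = real r * (real n - real r + 1)"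
    using iV by (simp add: i of_nat_diff)
  have "(\<Sum>T\<in>level V r. walk_kernel n r S T)
      = (1 - 2 * real r * (real n - real r + 1) / real n ^ 2) * (\<Sum>T\<in>level V r. of_bool (S = T))
        + 2 / real n ^ 2 * (\<Sum>T\<in>level V r. johnson_kernel r S T)"
    by (simp add: walk_kernel_def kernel_affine_def sum.distrib sum_distrib_left)
  also have "(\<Sum>T\<in>level V r. of_bool (S = T)) = (1::real)"
    using S finite_level[OF V(1), of r] by (simp add: of_bool_def)
  finally show ?thesis
    using n by (simp add: J)
qed

definition subset_fiber :: "nat \<Rightarrow> nat \<Rightarrow> nat set \<Rightarrow> (nat \<Rightarrow> nat) set" where
  "subset_fiber n r T = {g. g permutes {1..n} \<and> g ` {1..r} = T}"

lemma initial_segment_level: "r \<le> n \<Longrightarrow> {1..r} \<in> level {1..n} r"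
  by (simp add: level_def)

lemma finite_subset_fiber: "finite (subset_fiber n r T)"
  unfolding subset_fiber_def by (rule finite_subset[OF _ finite_permutations[of "{1..n}"]]) auto

lemma young_subgroup_eq_fiber:
  assumes "r \<le> n"
  shows "young_subgroup n r = subset_fiber n r {1..r}"
proof -
  have "g ` {r+1..n} = {r+1..n}" if g: "g permutes {1..n}" "g ` {1..r} = {1..r}" for g
  proof -
    have "{r+1..n} = {1..n} - {1..r}" using assms by auto
    then show ?thesis
      using g permutes_image[OF g(1)] by (simp add: image_set_diff permutes_inj)
  qed
  then show ?thesis
    by (auto simp: young_subgroup_def subset_fiber_def sym_group_carrier)
qed

lemma left_coset_eq_fiber:
  assumes r: "r \<le> n" and a: "a permutes {1..n}"
  shows "a <#\<^bsub>sym_group n\<^esub> young_subgroup n r = subset_fiber n r (a ` {1..r})"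
proof (intro equalityI subsetI)
  fix g assume "g \<in> a <#\<^bsub>sym_group n\<^esub> young_subgroup n r"
  then obtain h where "g = a \<circ> h" "h permutes {1..n}" "h ` {1..r} = {1..r}"
    by (auto simp: l_coset_def young_subgroup_eq_fiber[OF r] subset_fiber_def sym_group_mult)
  then show "g \<in> subset_fiber n r (a ` {1..r})"
    using a by (simp only: subset_fiber_def mem_Collect_eq permutes_compose image_comp[symmetric])
next
  fix g assume g: "g \<in> subset_fiber n r (a ` {1..r})"
  let ?h = "inv' a \<circ> g"
  have "?h permutes {1..n}"
    using g a by (simp add: subset_fiber_def permutes_compose permutes_inv)
  moreover have "?h ` {1..r} = {1..r}"
    using g image_inverse_permutes(1)[OF a] by (simp only: subset_fiber_def mem_Collect_eq image_comp[symmetric])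
  ultimately have "?h \<in> young_subgroup n r"
    by (simp only: young_subgroup_eq_fiber[OF r] subset_fiber_def mem_Collect_eq)
  moreover have "g = a \<circ> ?h"
    using permutes_inv_o(1)[OF a] by (simp add: comp_assoc[symmetric])
  ultimately show "g \<in> a <#\<^bsub>sym_group n\<^esub> young_subgroup n r"
    unfolding l_coset_def sym_group_mult by blast
qed

lemma coset_space_eq_fibers:
  assumes r: "r \<le> n"
  shows "coset_space n r = subset_fiber n r ` level {1..n} r"
proof -
  have "coset_space n r = (\<lambda>a. subset_fiber n r (a ` {1..r})) ` {a. a permutes {1..n}}"
    unfolding coset_space_def LCOSETS_def
    using left_coset_eq_fiber[OF r] by (auto simp: sym_group_carrier)
  also have "\<dots> = subset_fiber n r ` ((\<lambda>a. a ` {1..r}) ` {a. a permutes {1..n}})"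
    by (simp add: image_image)
  also have "(\<lambda>a. a ` {1..r}) ` {a. a permutes {1..n}} = level {1..n} r"
    using image_permutes_level[OF _ initial_segment_level[OF r]]
      permutes_transitive_level[OF _ initial_segment_level[OF r]]
    by (fastforce simp: image_iff)
  finally show ?thesis .
qed

lemma inj_on_subset_fiber:
  assumes r: "r \<le> n"
  shows "inj_on (subset_fiber n r) (level {1..n} r)"
proof (rule inj_onI)
  fix S T assume S: "S \<in> level {1..n} r" and eq: "subset_fiber n r S = subset_fiber n r T"
  obtain g where "g permutes {1..n}" "g ` {1..r} = S"
    using permutes_transitive_level[OF _ initial_segment_level[OF r] S] by auto
  then have "g \<in> subset_fiber n r T"
    using eq by (auto simp: subset_fiber_def)
  then show "S = T" using \<open>g ` {1..r} = S\<close> by (simp add: subset_fiber_def)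
qed

text \<open>
  Left multiplication permutes the fibres transitively, so the \<open>n!\<close> permutations are shared equally
  among the \<open>n choose r\<close> fibres.
\<close>

lemma card_subset_fiber:
  assumes r: "r \<le> n" and T: "T \<in> level {1..n} r"
  shows "card (subset_fiber n r T) = fact r * fact (n - r)"
proof -
  have eq: "card (subset_fiber n r S) = card (subset_fiber n r T)" if S: "S \<in> level {1..n} r" for S
  proof -
    obtain g where g: "g permutes {1..n}" "g ` S = T"
      using permutes_transitive_level[OF _ S T] by auto
    have T': "inv' g ` T = S"
      using g image_inverse_permutes(1)[OF g(1)] by metis
    have "bij_betw (\<lambda>h. g \<circ> h) (subset_fiber n r S) (subset_fiber n r T)"
    proof (rule bij_betw_byWitness[where f' = "\<lambda>h. inv' g \<circ> h"])
      show "(\<lambda>h. g \<circ> h) ` subset_fiber n r S \<subseteq> subset_fiber n r T"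
        using g by (intro image_subsetI) (simp only: subset_fiber_def mem_Collect_eq permutes_compose image_comp[symmetric])
      show "(\<lambda>h. inv' g \<circ> h) ` subset_fiber n r T \<subseteq> subset_fiber n r S"
        using g(1) T' by (intro image_subsetI) (simp only: subset_fiber_def mem_Collect_eq permutes_compose permutes_inv image_comp[symmetric])
    qed (simp_all add: comp_assoc[symmetric] permutes_inv_o[OF g(1)])
    then show ?thesis by (rule bij_betw_same_card)
  qed
  have "fact n = card {g. g permutes {1..n}}"
    by (simp add: card_permutations)
  also have "{g. g permutes {1..n}} = (\<Union>S\<in>level {1..n} r. subset_fiber n r S)"
    using image_permutes_level[OF _ initial_segment_level[OF r]] by (auto simp: subset_fiber_def)
  also have "card \<dots> = (\<Sum>S\<in>level {1..n} r. card (subset_fiber n r S))"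
    by (rule card_UN_disjoint) (auto simp: finite_level finite_subset_fiber, auto simp: subset_fiber_def)
  also have "\<dots> = (n choose r) * card (subset_fiber n r T)"
    using eq by (simp add: card_level)
  finally have "fact r * fact (n - r) * (n choose r) = card (subset_fiber n r T) * (n choose r)"
    using binomial_fact_lemma[OF r] by (metis mult.commute)
  moreover have "n choose r \<noteq> 0" using r by simp
  ultimately show ?thesis by (metis mult_cancel2)
qed


section \<open>From convolution powers to the spectral sum\<close>

lemma transpose_image_exchange:
  assumes "a \<in> S" "b \<notin> S"
  shows "Transposition.transpose a b ` S = insert b (S - {a})"
proof -
  have "Transposition.transpose a b ` insert a (S - {a}) = insert b (S - {a})"
    using assms by (simp only: image_insert transpose_apply_first) (simp add: transpose_image_eq)
  then show ?thesis using assms by (simp add: insert_absorb)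
qed

text \<open>
  A coset of \<open>T\<^sub>2 K\<close> is one whose subset arises from \<open>{1..r}\<close> by a single exchange. Conversely,
  the transposition of the two exchanged points carries \<open>g ` {1..r}\<close> back to \<open>{1..r}\<close>.
\<close>

lemma mem_outer_transposition_cosets_iff:
  assumes r: "1 \<le> r" "r \<le> n" and g: "g permutes {1..n}" and ne: "g ` {1..r} \<noteq> {1..r}"
  shows "g \<in> outer_transpositions n r <#>\<^bsub>sym_group n\<^esub> young_subgroup n r
     \<longleftrightarrow> card ({1..r} \<inter> g ` {1..r}) + 1 = r"
proof
  assume "g \<in> outer_transpositions n r <#>\<^bsub>sym_group n\<^esub> young_subgroup n r"
  then obtain i j h where ij: "i \<in> {1..n}" "j \<in> {1..n}" "i \<noteq> j"
    and h: "h ` {1..r} = {1..r}" and gh: "g = Transposition.transpose i j \<circ> h"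
    by (auto simp: set_mult_def outer_transpositions_def young_subgroup_eq_fiber[OF r(2)]
        subset_fiber_def sym_group_mult)
  have gi: "g ` {1..r} = Transposition.transpose i j ` {1..r}"
    using h by (simp only: gh image_comp[symmetric])
  have swap: "card ({1..r} \<inter> Transposition.transpose a b ` {1..r}) + 1 = r"
    if "a \<in> {1..r}" "b \<notin> {1..r}" for a b
  proof -
    have "{1..r} \<inter> Transposition.transpose a b ` {1..r} = {1..r} - {a}"
      unfolding transpose_image_exchange[OF that] using that by blast
    then show ?thesis using that r by simp
  qed
  have "(i \<in> {1..r} \<and> j \<notin> {1..r}) \<or> (j \<in> {1..r} \<and> i \<notin> {1..r})"
    using ne gi by (metis transpose_image_eq)
  then show "card ({1..r} \<inter> g ` {1..r}) + 1 = r"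
    using swap[of i j] swap[of j i] gi by (auto simp: transpose_commute)
next
  let ?S = "{1..r}" and ?T = "g ` {1..r}"
  assume c: "card (?S \<inter> ?T) + 1 = r"
  have T: "?T \<in> level {1..n} r"
    using image_permutes_level[OF g initial_segment_level[OF r(2)]] .
  then have cT: "card ?T = r" "?T \<subseteq> {1..n}" by (auto simp: level_def)
  have "card (?S - ?T) = 1" "card (?T - ?S) = 1"
    using c cT card_Diff_subset_Int[of ?S ?T] card_Diff_subset_Int[of ?T ?S]
    by (simp_all add: Int_commute)
  then obtain i j where i: "?S - ?T = {i}" and j: "?T - ?S = {j}"
    by (metis card_1_singletonE)
  let ?t = "Transposition.transpose i j"
  have "i \<in> ?S" "j \<notin> ?S" "i \<notin> ?T" "j \<in> ?T"
    using i j by blast+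
  moreover have "?S \<subseteq> {1..n}" using r by simp
  ultimately have ij: "i \<in> {1..n}" "j \<in> {1..n}" "i \<noteq> j" "i \<in> ?S" "j \<notin> ?S" "i \<notin> ?T" "j \<in> ?T"
    using cT(2) by blast+
  have tT: "?t ` ?T = ?S"
  proof -
    have "?t ` ?T = insert i (?T - {j})"
      using transpose_image_exchange[of j ?T i] ij by (simp only: transpose_commute not_False_eq_True)
    also have "\<dots> = ?S" using i j ij by blast
    finally show ?thesis .
  qed
  have perm: "?t permutes {1..n}" using ij by (intro permutes_swap_id)
  have "?t \<notin> young_subgroup n r"
  proof
    assume "?t \<in> young_subgroup n r"
    then have "?t ` ?S = ?S" by (simp add: young_subgroup_def)
    then have "?t i \<in> ?S" using ij by blast
    then show False using ij by simp
  qed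
  then have "?t \<in> outer_transpositions n r"
    unfolding outer_transpositions_def using ij(1-3) by blast
  moreover have "?t \<circ> g \<in> young_subgroup n r"
    using tT perm g
    by (simp only: young_subgroup_eq_fiber[OF r(2)] subset_fiber_def mem_Collect_eq
        image_comp[symmetric] permutes_compose)
  moreover have "g = ?t \<circ> (?t \<circ> g)" by (simp add: comp_assoc[symmetric])
  ultimately show "g \<in> outer_transpositions n r <#>\<^bsub>sym_group n\<^esub> young_subgroup n r"
    by (auto simp: set_mult_def sym_group_mult)
qed

lemma step_measure_eq_walk_kernel:
  assumes r: "1 \<le> r" "r \<le> n" and g: "g permutes {1..n}"
  shows "step_measure n r g = walk_kernel n r {1..r} (g ` {1..r}) / (fact r * fact (n - r))"
proof -
  have n: "real n > 0" using r by simp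
  have mem: "g \<in> young_subgroup n r \<longleftrightarrow> g ` {1..r} = {1..r}"
    using g by (simp add: young_subgroup_eq_fiber[OF r(2)] subset_fiber_def)
  show ?thesis
  proof (cases "g ` {1..r} = {1..r}")
    case True
    have "(real n ^ 2 - 2 * real r * (real n - real r)) / real n ^ 2
        = 1 - 2 * real r * (real n - real r + 1) / real n ^ 2 + 2 / real n ^ 2 * real r"
      using n by (simp add: field_simps)
    then show ?thesis
      using True mem by (simp add: step_measure_def walk_kernel_def kernel_affine_def
          johnson_kernel_def mult.assoc divide_divide_eq_left[symmetric] del: divide_divide_eq_left)
  next
    case False
    then show ?thesis
      using mem mem_outer_transposition_cosets_iff[OF r g False] False[symmetric]
      by (simp add: step_measure_def walk_kernel_def kernel_affine_def johnson_kernel_def)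
  qed
qed

lemma sum_permutations_by_fiber:
  assumes r: "r \<le> n"
  shows "(\<Sum>g | g permutes {1..n}. F (g ` {1..r}))
       = fact r * fact (n - r) * (\<Sum>T\<in>level {1..n} r. F T :: real)"
proof -
  have "(\<Sum>g | g permutes {1..n}. F (g ` {1..r}))
      = (\<Sum>T\<in>level {1..n} r. \<Sum>g | g \<in> {g. g permutes {1..n}} \<and> g ` {1..r} = T. F (g ` {1..r}))"
    using image_permutes_level[OF _ initial_segment_level[OF r]]
    by (intro sum.group[symmetric]) (auto simp: finite_permutations finite_level)
  also have "\<dots> = (\<Sum>T\<in>level {1..n} r. \<Sum>g\<in>subset_fiber n r T. F T)"
    by (intro sum.cong refl) (auto simp: subset_fiber_def)
  also have "\<dots> = fact r * fact (n - r) * (\<Sum>T\<in>level {1..n} r. F T)"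
    by (simp add: card_subset_fiber[OF r] sum_distrib_left)
  finally show ?thesis .
qed

lemma sum_group_convolution:
  assumes "group G"
  shows "(\<Sum>g\<in>carrier G. group_convolution G A B g * F g)
       = (\<Sum>u\<in>carrier G. A u * (\<Sum>h\<in>carrier G. B h * F (u \<otimes>\<^bsub>G\<^esub> h)))"
proof -
  interpret group G by fact
  have "(\<Sum>g\<in>carrier G. group_convolution G A B g * F g)
      = (\<Sum>g\<in>carrier G. \<Sum>h\<in>carrier G. A (g \<otimes>\<^bsub>G\<^esub> inv\<^bsub>G\<^esub> h) * B h * F g)"
    by (simp add: group_convolution_def sum_distrib_right)
  also have "\<dots> = (\<Sum>h\<in>carrier G. \<Sum>g\<in>carrier G. A (g \<otimes>\<^bsub>G\<^esub> inv\<^bsub>G\<^esub> h) * B h * F g)"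
    by (rule sum.swap)
  also have "\<dots> = (\<Sum>h\<in>carrier G. \<Sum>u\<in>carrier G. A u * B h * F (u \<otimes>\<^bsub>G\<^esub> h))"
  proof (rule sum.cong[OF refl])
    fix h assume h: "h \<in> carrier G"
    show "(\<Sum>g\<in>carrier G. A (g \<otimes>\<^bsub>G\<^esub> inv\<^bsub>G\<^esub> h) * B h * F g)
        = (\<Sum>u\<in>carrier G. A u * B h * F (u \<otimes>\<^bsub>G\<^esub> h))"
      by (rule sum.reindex_bij_witness[where i = "\<lambda>u. u \<otimes>\<^bsub>G\<^esub> h" and j = "\<lambda>g. g \<otimes>\<^bsub>G\<^esub> inv\<^bsub>G\<^esub> h"])
        (use h in \<open>simp_all add: m_assoc\<close>)
  qed
  also have "\<dots> = (\<Sum>u\<in>carrier G. \<Sum>h\<in>carrier G. A u * B h * F (u \<otimes>\<^bsub>G\<^esub> h))"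
    by (rule sum.swap)
  finally show ?thesis by (simp add: sum_distrib_left mult.assoc)
qed

text \<open>
  The definition of convolution powers puts a new factor on the left, whereas the walk on cosets
  multiplies on the right. Letting a permutation \<open>x\<close> and a test function \<open>\<phi>\<close> vary reconciles the
  two: the leftmost factor \<open>u\<close> is absorbed into \<open>x\<close>, and by induction the rest is the function
  \<open>P\<^sup>k \<phi>\<close> at \<open>xu ` {1..r}\<close>. Averaging over \<open>u\<close> applies \<open>P\<close> once more, because
  \<open>P\<close> is invariant under \<open>x\<close>.
\<close>

lemma convolution_power_eq_kernel_power:
  assumes r: "1 \<le> r" "r \<le> n" and x: "x permutes {1..n}"
  shows "(\<Sum>g\<in>carrier (sym_group n). convolution_power (sym_group n) (step_measure n r) k g * \<phi> (x ` g ` {1..r}))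
       = (\<Sum>T\<in>level {1..n} r. kernel_power (level {1..n} r) (walk_kernel n r) k (x ` {1..r}) T * \<phi> T)"
  using x
proof (induction k arbitrary: x)
  let ?L = "level {1..n} r" and ?G = "sym_group n" and ?P = "walk_kernel n r :: nat set \<Rightarrow> nat set \<Rightarrow> real"
  have carr: "carrier ?G = {g. g permutes {1..n}}" by (simp add: sym_group_def)
  have finG: "finite (carrier ?G)" by (simp add: carr finite_permutations)
  have finL: "finite ?L" by (simp add: finite_level)
  {
    case 0
    have "(\<Sum>g\<in>carrier ?G. convolution_power ?G (step_measure n r) 0 g * \<phi> (x ` g ` {1..r}))
        = (\<Sum>g\<in>carrier ?G. if g = id then \<phi> (x ` id ` {1..r}) else 0)"
      by (intro sum.cong) (auto simp: sym_group_one)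
    also have "\<dots> = \<phi> (x ` {1..r})"
      using finG by (simp add: carr permutes_id)
    also have "\<dots> = (\<Sum>T\<in>?L. if x ` {1..r} = T then \<phi> T else 0)"
      using finL image_permutes_level[OF 0 initial_segment_level[OF r(2)]] by simp
    also have "\<dots> = (\<Sum>T\<in>?L. kernel_power ?L ?P 0 (x ` {1..r}) T * \<phi> T)"
      by (intro sum.cong) auto
    finally show ?case .
  next
    case (Suc k)
    \<comment> \<open>the function \<open>P\<^sup>k \<phi>\<close>\<close>
    let ?\<psi> = "\<lambda>S. \<Sum>T\<in>?L. kernel_power ?L ?P k S T * \<phi> T"
    have xS: "x ` {1..r} \<in> ?L"
      using image_permutes_level[OF Suc.prems initial_segment_level[OF r(2)]] .
    have "(\<Sum>g\<in>carrier ?G. convolution_power ?G (step_measure n r) (Suc k) g * \<phi> (x ` g ` {1..r}))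
        = (\<Sum>u\<in>carrier ?G. step_measure n r u *
            (\<Sum>h\<in>carrier ?G. convolution_power ?G (step_measure n r) k h * \<phi> ((x \<circ> u) ` h ` {1..r})))"
      unfolding convolution_power.simps sum_group_convolution[OF sym_group_is_group]
      by (simp only: sym_group_mult image_comp[symmetric])
    also have "\<dots> = (\<Sum>u | u permutes {1..n}. step_measure n r u * ?\<psi> ((x \<circ> u) ` {1..r}))"
      unfolding carr
      by (intro sum.cong refl arg_cong2[of _ _ _ _ "(*)"], rule Suc.IH[unfolded carr])
        (metis Suc.prems mem_Collect_eq permutes_compose)
    also have "\<dots> = (\<Sum>u | u permutes {1..n}.
        ?P {1..r} (u ` {1..r}) / (fact r * fact (n - r)) * ?\<psi> (x ` u ` {1..r}))"
      using r by (intro sum.cong) (simp_all add: step_measure_eq_walk_kernel image_comp)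
    also have "\<dots> = fact r * fact (n - r) * (\<Sum>S\<in>?L. ?P {1..r} S / (fact r * fact (n - r)) * ?\<psi> (x ` S))"
      by (rule sum_permutations_by_fiber[OF r(2)])
    also have "\<dots> = (\<Sum>S\<in>?L. ?P {1..r} S * ?\<psi> (x ` S))"
      by (simp add: sum_distrib_left)
    also have "\<dots> = (\<Sum>S\<in>?L. ?P (x ` {1..r}) (x ` S) * ?\<psi> (x ` S))"
      using walk_kernel_image[OF permutes_inj[OF Suc.prems]] by simp
    also have "\<dots> = (\<Sum>S\<in>?L. ?P (x ` {1..r}) S * ?\<psi> S)"
      by (rule sum.reindex_bij_betw[OF bij_betw_image_level[OF Suc.prems]])
    also have "\<dots> = (\<Sum>S\<in>?L. \<Sum>T\<in>?L. ?P (x ` {1..r}) S * kernel_power ?L ?P k S T * \<phi> T)"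
      by (simp add: sum_distrib_left mult.assoc)
    also have "\<dots> = (\<Sum>T\<in>?L. \<Sum>S\<in>?L. ?P (x ` {1..r}) S * kernel_power ?L ?P k S T * \<phi> T)"
      by (rule sum.swap)
    also have "\<dots> = (\<Sum>T\<in>?L. kernel_mult ?L ?P (kernel_power ?L ?P k) (x ` {1..r}) T * \<phi> T)"
      by (simp add: kernel_mult_def sum_distrib_right)
    also have "\<dots> = (\<Sum>T\<in>?L. kernel_power ?L ?P (Suc k) (x ` {1..r}) T * \<phi> T)"
      using kernel_power_Suc_left[OF finL xS] by (intro sum.cong refl) metis
    finally show ?case .
  }
qed

lemma induced_measure_fiber:
  assumes r: "1 \<le> r" "r \<le> n" and T: "T \<in> level {1..n} r"
  shows "induced_measure (convolution_power (sym_group n) (step_measure n r) k) (subset_fiber n r T)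
       = kernel_power (level {1..n} r) (walk_kernel n r) k {1..r} T"
proof -
  let ?Q = "convolution_power (sym_group n) (step_measure n r) k"
  have "induced_measure ?Q (subset_fiber n r T)
      = (\<Sum>g\<in>carrier (sym_group n). ?Q g * of_bool (id ` g ` {1..r} = T))"
    unfolding induced_measure_def
    by (rule sum.mono_neutral_cong_left)
      (auto simp: sym_group_def subset_fiber_def finite_permutations)
  also have "\<dots> = (\<Sum>S\<in>level {1..n} r.
      kernel_power (level {1..n} r) (walk_kernel n r) k (id ` {1..r}) S * of_bool (S = T))"
    by (rule convolution_power_eq_kernel_power[OF r permutes_id])
  also have "\<dots> = kernel_mult (level {1..n} r)
      (kernel_power (level {1..n} r) (walk_kernel n r) k) (\<lambda>x y. of_bool (x = y)) {1..r} T"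
    by (simp add: kernel_mult_def)
  also have "\<dots> = kernel_power (level {1..n} r) (walk_kernel n r) k {1..r} T"
    using T by (intro kernel_mult_identity_right finite_level) auto
  finally show ?thesis .
qed

text \<open>
  By symmetry of \<open>P\<close>, the squares in a row of \<open>P\<^sup>k\<close> sum to a diagonal entry of \<open>P\<^sup>2\<^sup>k\<close>. All diagonal
  entries are equal by transitivity, so it is the trace divided by \<open>n choose r\<close>. The term \<open>j = 0\<close> of
  the trace is \<open>1\<close> and cancels against the uniform measure.
\<close>

lemma l2_distance_spectral:
  fixes n r k :: nat
  assumes r: "1 \<le> r" "r \<le> n"
  defines "X \<equiv> coset_space n r"
  defines "\<mu> \<equiv> induced_measure (convolution_power (sym_group n) (step_measure n r) k)"
  shows "real (n choose r) * l2_distance X \<mu> (uniform_coset_measure n r) ^ 2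
       = (\<Sum>j=1..r. johnson_multiplicity n j * walk_eigenvalue n j ^ (2 * k))"
proof -
  let ?L = "level {1..n} r" and ?S = "{1..r}" and ?P = "walk_kernel n r :: nat set \<Rightarrow> nat set \<Rightarrow> real"
  let ?N = "real (n choose r)" and ?K = "kernel_power ?L ?P"
  have finL: "finite ?L" by (simp add: finite_level)
  have N: "?N > 0" using r by simp
  have n: "n > 0" using r by simp
  have S: "?S \<in> ?L" by (rule initial_segment_level[OF r(2)])
  have row: "(\<Sum>T\<in>?L. ?K k ?S T) = 1"
    using n r S by (intro kernel_power_row_sum finL walk_kernel_row_sum) simp_all
  have square: "(\<Sum>T\<in>?L. ?K k ?S T ^ 2) = ?K (2 * k) ?S ?S"
  proof -
    have "?K (k + k) ?S ?S = kernel_mult ?L (?K k) (?K k) ?S ?S"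
      using finL S S by (rule kernel_power_add)
    also have "\<dots> = (\<Sum>T\<in>?L. ?K k ?S T ^ 2)"
      unfolding kernel_mult_def power2_eq_square
      by (intro sum.cong refl arg_cong2[of _ _ _ _ "(*)"] kernel_power_symmetric finL
          walk_kernel_symmetric S)
    finally show ?thesis by (simp add: mult_2)
  qed
  have diag: "?K m T T = ?K m ?S ?S" if T: "T \<in> ?L" for T m
  proof -
    obtain g where g: "g permutes {1..n}" "g ` ?S = T"
      using permutes_transitive_level[OF _ S T] by auto
    have "?K m (g ` ?S) (g ` ?S) = ?K m ?S ?S"
      by (rule kernel_power_equivariant[OF bij_betw_image_level[OF g(1)] _ S S])
        (rule walk_kernel_image[OF permutes_inj[OF g(1)]])
    then show ?thesis using g(2) by simp
  qed
  have "?N * ?K (2 * k) ?S ?S = kernel_trace ?L (?K (2 * k))"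
    using diag by (simp add: kernel_trace_def card_level)
  also have "\<dots> = (\<Sum>j\<le>r. johnson_multiplicity n j
      * (1 - 2 * real r * (real n - real r + 1) / real n ^ 2
         + 2 / real n ^ 2 * ((real r - real j) * (real n - real r - real j + 1))) ^ (2 * k))"
    unfolding walk_kernel_def by (subst trace_johnson_power) simp_all
  also have "\<dots> = (\<Sum>j\<le>r. johnson_multiplicity n j * walk_eigenvalue n j ^ (2 * k))"
    using n by (intro sum.cong refl arg_cong2[of _ _ _ _ "(*)"] arg_cong[of _ _ "\<lambda>u. u ^ (2 * k)"])
      (simp add: walk_eigenvalue_def field_simps)
  also have "{..r} = insert 0 {1..r}" by auto
  also have "(\<Sum>j\<in>insert 0 {1..r}. johnson_multiplicity n j * walk_eigenvalue n j ^ (2 * k))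
      = 1 + (\<Sum>j=1..r. johnson_multiplicity n j * walk_eigenvalue n j ^ (2 * k))"
    by (simp add: johnson_multiplicity_def walk_eigenvalue_def)
  finally have trace: "?N * ?K (2 * k) ?S ?S
      = 1 + (\<Sum>j=1..r. johnson_multiplicity n j * walk_eigenvalue n j ^ (2 * k))" .
  have "l2_distance X \<mu> (uniform_coset_measure n r) ^ 2
      = (\<Sum>C\<in>X. (\<mu> C - uniform_coset_measure n r C) ^ 2)"
    by (simp add: l2_distance_def L2_set_def sum_nonneg)
  also have "\<dots> = (\<Sum>T\<in>?L. (?K k ?S T - 1 / ?N) ^ 2)"
    unfolding X_def coset_space_eq_fibers[OF r(2)]
    by (subst sum.reindex[OF inj_on_subset_fiber[OF r(2)]])
      (simp add: \<mu>_def induced_measure_fiber[OF r] uniform_coset_measure_def)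
  also have "\<dots> = (\<Sum>T\<in>?L. ?K k ?S T ^ 2 - 2 / ?N * ?K k ?S T + 1 / ?N ^ 2)"
    by (intro sum.cong) (simp_all add: power2_diff power_divide)
  also have "\<dots> = ?K (2 * k) ?S ?S - 2 / ?N + ?N * (1 / ?N ^ 2)"
    by (simp only: sum.distrib sum_subtractf sum_distrib_left[symmetric] square row)
      (simp add: card_level)
  finally have "?N * l2_distance X \<mu> (uniform_coset_measure n r) ^ 2 = ?N * ?K (2 * k) ?S ?S - 1"
    using N by (simp add: field_simps power2_eq_square)
  then show ?thesis using trace by simp
qed

lemma tv_distance_le_l2_distance:
  assumes "finite X"
  shows "tv_distance X \<mu> \<nu> \<le> 1 / 2 * sqrt (real (card X)) * l2_distance X \<mu> \<nu>"
proof -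
  have "(\<Sum>x\<in>X. \<bar>1\<bar> * \<bar>\<mu> x - \<nu> x\<bar>) \<le> L2_set (\<lambda>x. 1) X * L2_set (\<lambda>x. \<mu> x - \<nu> x) X"
    by (rule L2_set_mult_ineq)
  then show ?thesis
    by (simp add: tv_distance_def l2_distance_def L2_set_def)
qed

theorem theorem2p5p3:
  shows "\<exists>a::real. a > 0 \<and>
    (\<forall>(n::nat) (r::nat) (c::real) (k::nat).
       1 \<le> r \<and> real r \<le> real n / 2 \<and> c > 0 \<and> real k = 1 / 4 * real n * (ln (real n) + c) \<longrightarrow>
       (let X = coset_space n r;
            \<mu> = induced_measure (convolution_power (sym_group n) (step_measure n r) k);
            U = uniform_coset_measure n r
        in tv_distance X \<mu> U \<le> 1 / 2 * sqrt (real (n choose r)) * l2_distance X \<mu> U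
           \<and> 1 / 2 * sqrt (real (n choose r)) * l2_distance X \<mu> U \<le> a * exp (- c / 2)))"
proof -
  define s where "s = suminf comparison_term"
  have s: "s > 0"
    unfolding s_def using summable_comparison_term comparison_term_pos by (rule suminf_pos)
  have bound: "tv_distance (coset_space n r) \<mu> U
        \<le> 1 / 2 * sqrt (real (n choose r)) * l2_distance (coset_space n r) \<mu> U
      \<and> 1 / 2 * sqrt (real (n choose r)) * l2_distance (coset_space n r) \<mu> U
        \<le> 1 / 2 * sqrt s * exp (- c / 2)"
    if r: "1 \<le> r" "real r \<le> real n / 2" and c: "c > 0"
      and k: "real k = 1 / 4 * real n * (ln (real n) + c)"
      and \<mu>: "\<mu> = induced_measure (convolution_power (sym_group n) (step_measure n r) k)"
      and U: "U = uniform_coset_measure n r"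
    for n r k :: nat and c :: real and \<mu> U
  proof -
    have rn: "r \<le> n" "2 * r \<le> n" and n: "n \<ge> 2" using r by linarith+
    let ?X = "coset_space n r"
    have X: "finite ?X" "card ?X = n choose r"
      using card_image[OF inj_on_subset_fiber[OF rn(1)]]
      by (simp_all add: coset_space_eq_fibers[OF rn(1)] finite_level card_level)
    have "real (n choose r) * l2_distance ?X \<mu> U ^ 2
        = (\<Sum>j=1..r. johnson_multiplicity n j * walk_eigenvalue n j ^ (2 * k))"
      unfolding \<mu> U by (rule l2_distance_spectral[OF r(1) rn(1)])
    also have "\<dots> \<le> (\<Sum>j=1..r. comparison_term j * exp (- c))"
      using rn n c k by (intro sum_mono eigenvalue_term_bound) auto
    also have "\<dots> = (\<Sum>j=1..r. comparison_term j) * exp (- c)"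
      by (simp add: sum_distrib_right)
    also have "\<dots> \<le> s * exp (- c)"
      unfolding s_def using summable_comparison_term comparison_term_pos
      by (intro mult_right_mono sum_le_suminf) (auto intro: less_imp_le)
    finally have "sqrt (real (n choose r) * l2_distance ?X \<mu> U ^ 2) \<le> sqrt (s * exp (- c))"
      by simp
    moreover have "l2_distance ?X \<mu> U \<ge> 0"
      by (simp add: l2_distance_def)
    moreover have "sqrt (exp (- c)) = exp (- c / 2)"
      by (rule real_sqrt_unique) (simp_all flip: exp_of_nat_mult)
    ultimately have "sqrt (real (n choose r)) * l2_distance ?X \<mu> U \<le> sqrt s * exp (- c / 2)"
      by (simp add: real_sqrt_mult)
    then show ?thesis
      using tv_distance_le_l2_distance[OF X(1), of \<mu> U] X(2) by simp
  qed
  show ?thesis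
  proof (intro exI[of _ "1 / 2 * sqrt s"] conjI allI impI)
    show "1 / 2 * sqrt s > 0" using s by simp
  qed (unfold Let_def, elim conjE, rule bound, (assumption | rule refl)+)
qed

end
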